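(* Let $S$ be a numerical semigroup with multiplicity $4$ and $\mathrm{Ap}(S,4)=\{0,4x_1+1,4x_2+2,4x_3+3\}$. Then $S$ is $4$-irreducible if and only if one of the following conditions holds: \begin{enumerate} \item $x_1=x_2=x_3=1$; \item $x_1+x_2\ge x_3+1$, $2x_1\ge x_2+2$, and $x_2+x_3\le x_1-1$; \item $x_1+x_2\ge x_3+1$, $2x_1\ge x_2+2$, $x_2=1$ and $2x_3\le x_2$; \item $x_1+x_2\ge x_3+1$, $2x_1\ge x_2+2$, $x_2=1$ and $x_2+x_3\le x_1-1$; \item $x_1=2$, $x_2=x_3=1$; \item $x_1+x_2\ge x_3+1$, $x_2+x_3\ge x_1$, $2x_1\le x_2+1$ and $2x_3\le x_2$; \item $x_2+x_3\ge x_1$, $2x_3\ge x_2+1$, and $x_1+x_2\le x_3$. \end{enumerate}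
   Context: $\mathbb{N}$ denotes the set of non-negative integers. A numerical semigroup is a subset $S\subseteq\mathbb{N}$ that is closed under addition, contains $0$ and has finite complement $\mathbb{N}\setminus S$. The multiplicity of $S$ is the smallest positive integer belonging to $S$. For $s\in S\setminus\{0\}$, the Ap\'ery set of $S$ with respect to $s$ is $\mathrm{Ap}(S,s)=\{w_0=0,w_1,\dots,w_{s-1}\}$, where $w_i$ is the least element of $S$ congruent to $i$ modulo $s$. A numerical semigroup with multiplicity $m$ is $m$-irreducible if it cannot be expressed as an intersection of two numerical semigroups with multiplicity $m$ containing it properly. *)

theory Defs
  imports Main
begin

definition numerical_semigroup :: "nat set \<Rightarrow> bool" where
  "numerical_semigroup S \<longleftrightarrow>
     0 \<in> S \<and> (\<forall>a\<in>S. \<forall>b\<in>S. a + b \<in> S) \<and> finite (UNIV - S)"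

definition multiplicity :: "nat set \<Rightarrow> nat" where
  "multiplicity S = (LEAST n. n \<in> S \<and> 0 < n)"

definition apery_element :: "nat set \<Rightarrow> nat \<Rightarrow> nat \<Rightarrow> nat" where
  "apery_element S s i = (LEAST w. w \<in> S \<and> w mod s = i mod s)"

definition apery_set :: "nat set \<Rightarrow> nat \<Rightarrow> nat set" where
  "apery_set S s = apery_element S s ` {0..<s}"

definition m_irreducible :: "nat \<Rightarrow> nat set \<Rightarrow> bool" where
  "m_irreducible m S \<longleftrightarrow>
     numerical_semigroup S \<and> multiplicity S = m \<and>
     \<not> (\<exists>T U. numerical_semigroup T \<and> multiplicity T = m \<and> S \<subset> T \<and>
              numerical_semigroup U \<and> multiplicity U = m \<and> S \<subset> U \<and>
              S = T \<inter> U)"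

end

theory Submission
  imports Defs
begin

text \<open>
  A numerical semigroup \<open>S\<close> with multiplicity 4 is determined by its three Kunz coordinates
  \<open>x1\<close>, \<open>x2\<close>, \<open>x3\<close>: in the residue class \<open>i\<close> modulo 4 it consists of the numbers \<open>\<ge> 4 * xi + i\<close>.
  Closure under addition amounts to four linear inequalities between the coordinates
  (\<open>kunz_tuple\<close>), one for each sum of two nonzero residues that is nonzero modulo 4.
  In these coordinates inclusion is the reversed componentwise order and intersection is the
  componentwise maximum (\<open>kunz_semigroup_subset_iff\<close>, \<open>kunz_semigroup_Int\<close>).

  Hence \<open>S\<close> is 4-irreducible iff its tuple is not the maximum of two smaller Kunz tuples.
  Two coordinates that can each be lowered by one would give such a pair. Conversely, adjoining
  to \<open>S\<close> the largest element of \<open>T - S\<close>, for any larger semigroup \<open>T\<close> of multiplicity 4, gives a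
  semigroup again; so a Kunz tuple below \<open>(x1, x2, x3)\<close> always comes with a coordinate, among
  those where it is smaller, that can be lowered by one (\<open>smaller_kunz_tuple_lowers_coordinate\<close>). Two
  smaller tuples with maximum \<open>(x1, x2, x3)\<close> are never smaller in the same coordinate, so they yield two
  different such coordinates. Therefore \<open>S\<close> is 4-irreducible iff at most one coordinate can be
  lowered (\<open>m_irreducible_kunz_semigroup_iff\<close>), and the seven conditions are a case
  distinction of this in linear arithmetic.
\<close>

section \<open>Membership in terms of Apery elements\<close>

lemma multiplicity_props:
  assumes "numerical_semigroup S"
  shows "multiplicity S \<in> S" "0 < multiplicity S"
    "\<And>n. n \<in> S \<Longrightarrow> 0 < n \<Longrightarrow> multiplicity S \<le> n"
proof -
  have "infinite S"
    using assms finite_Diff2 infinite_UNIV_nat unfolding numerical_semigroup_def by blast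
  then have "\<exists>n. n \<in> S \<and> 0 < n"
    by (metis finite.emptyI finite_insert finite_subset gr0I insertI1 subsetI)
  then show "multiplicity S \<in> S" "0 < multiplicity S"
    unfolding multiplicity_def by (metis (mono_tags, lifting) LeastI_ex)+
  show "\<And>n. n \<in> S \<Longrightarrow> 0 < n \<Longrightarrow> multiplicity S \<le> n"
    unfolding multiplicity_def by (simp add: Least_le)
qed

lemma add_multiple_mem:
  assumes "numerical_semigroup S" "s \<in> S" "w \<in> S"
  shows "w + k * s \<in> S"
proof (induction k)
  case 0
  show ?case using assms(3) by simp
next
  case (Suc k)
  have "(w + k * s) + s \<in> S"
    using assms Suc unfolding numerical_semigroup_def by blast
  then show ?case by (simp add: ac_simps)
qed

lemma apery_element_props:
  assumes "numerical_semigroup S" "0 < s"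
  shows "apery_element S s i \<in> S" "apery_element S s i mod s = i mod s"
proof -
  obtain B where B: "\<forall>m\<in>UNIV - S. m < B"
    using assms(1) unfolding numerical_semigroup_def by (metis finite_nat_set_iff_bounded)
  have "B \<le> B * s"
    using assms(2) by (cases s) simp_all
  then have "\<not> i + B * s < B" by linarith
  then have "i + B * s \<in> S \<and> (i + B * s) mod s = i mod s"
    using B by auto
  then have "apery_element S s i \<in> S \<and> apery_element S s i mod s = i mod s"
    unfolding apery_element_def by (rule LeastI)
  then show "apery_element S s i \<in> S" "apery_element S s i mod s = i mod s" by auto
qed

lemma mem_iff_apery_element_le:
  assumes "numerical_semigroup S" "0 < s" "s \<in> S"
  shows "n \<in> S \<longleftrightarrow> apery_element S s n \<le> n"
proof
  assume "n \<in> S"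
  then show "apery_element S s n \<le> n"
    unfolding apery_element_def by (simp add: Least_le)
next
  assume le: "apery_element S s n \<le> n"
  then have "s dvd n - apery_element S s n"
    using apery_element_props(2)[OF assms(1,2), of n] by (metis mod_eq_dvd_iff_nat)
  with le obtain k where "n = apery_element S s n + s * k"
    by (metis dvdE le_add_diff_inverse)
  then show "n \<in> S"
    using add_multiple_mem[OF assms(1,3) apery_element_props(1)[OF assms(1,2), of n], of k]
    by (simp add: mult.commute)
qed

section \<open>Kunz coordinates for multiplicity 4\<close>

text \<open>The last two inequalities carry a \<open>+ 1\<close> because the sums \<open>2 + 3\<close> and \<open>3 + 3\<close> of residues
  overflow 4; the sums \<open>1 + 3\<close> and \<open>2 + 2\<close> give residue 0 and hence no condition.\<close>

definition kunz_tuple :: "nat \<Rightarrow> nat \<Rightarrow> nat \<Rightarrow> bool" where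
  "kunz_tuple a b c \<longleftrightarrow> 1 \<le> a \<and> 1 \<le> b \<and> 1 \<le> c \<and>
     b \<le> 2 * a \<and> c \<le> a + b \<and> a \<le> b + c + 1 \<and> b \<le> 2 * c + 1"

definition kunz_semigroup :: "nat \<Rightarrow> nat \<Rightarrow> nat \<Rightarrow> nat set" where
  "kunz_semigroup a b c = {n. (n mod 4 = 1 \<longrightarrow> 4 * a + 1 \<le> n) \<and>
     (n mod 4 = 2 \<longrightarrow> 4 * b + 2 \<le> n) \<and> (n mod 4 = 3 \<longrightarrow> 4 * c + 3 \<le> n)}"

lemma residues_mod_4:
  "(4 * k + 1) mod 4 = (1::nat)"
  "(4 * k + 2) mod 4 = (2::nat)" "(4 * k + 3) mod 4 = (3::nat)"
  by presburger+

lemma kunz_semigroup_generators: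
  "4 * a + 1 \<in> kunz_semigroup a' b' c' \<longleftrightarrow> a' \<le> a"
  "4 * b + 2 \<in> kunz_semigroup a' b' c' \<longleftrightarrow> b' \<le> b"
  "4 * c + 3 \<in> kunz_semigroup a' b' c' \<longleftrightarrow> c' \<le> c"
  unfolding kunz_semigroup_def mem_Collect_eq residues_mod_4 by simp_all

lemma numerical_semigroup_kunz_semigroup:
  assumes "kunz_tuple a b c"
  shows "numerical_semigroup (kunz_semigroup a b c)"
proof -
  have "UNIV - kunz_semigroup a b c \<subseteq> {..<4 * a + 4 * b + 4 * c + 3}"
    unfolding kunz_semigroup_def by auto
  then have "finite (UNIV - kunz_semigroup a b c)"
    by (rule finite_subset) simp
  moreover have "m + n \<in> kunz_semigroup a b c"
    if m: "m \<in> kunz_semigroup a b c" and n: "n \<in> kunz_semigroup a b c" for m n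
  proof -
    have sum: "(m + n) mod 4 = (m mod 4 + n mod 4) mod 4"
      by (simp add: mod_add_eq)
    have "m mod 4 \<in> {0, 1, 2, 3}" "n mod 4 \<in> {0, 1, 2, 3}"
      by auto
    then show ?thesis
      using m n assms sum unfolding kunz_semigroup_def kunz_tuple_def
      by (elim insertE emptyE) simp_all
  qed
  ultimately show ?thesis
    unfolding numerical_semigroup_def by (simp add: kunz_semigroup_def)
qed

lemma multiplicity_kunz_semigroup:
  assumes "kunz_tuple a b c"
  shows "multiplicity (kunz_semigroup a b c) = 4"
  unfolding multiplicity_def
proof (rule Least_equality)
  show "4 \<in> kunz_semigroup a b c \<and> 0 < (4::nat)"
    by (simp add: kunz_semigroup_def)
next
  fix n
  assume n: "n \<in> kunz_semigroup a b c \<and> 0 < n"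
  show "4 \<le> n"
  proof (rule ccontr)
    assume "\<not> 4 \<le> n"
    with n have "n \<in> {1, 2, 3}" by auto
    with n assms show False
      unfolding kunz_semigroup_def kunz_tuple_def by auto
  qed
qed

text \<open>Distinct residues force the listed Apery elements to be matched with the classes
  1, 2, 3 in this order, although \<open>apery_set\<close> is an unordered set.\<close>

lemma kunz_semigroup_of_apery_set:
  assumes S: "numerical_semigroup S" and mult: "multiplicity S = 4"
    and ap: "apery_set S 4 = {0, 4 * a + 1, 4 * b + 2, 4 * c + 3}"
  shows "S = kunz_semigroup a b c" "kunz_tuple a b c"
proof -
  have four: "4 \<in> S"
    using multiplicity_props(1)[OF S] mult by simp
  let ?A = "{0, 4 * a + 1, 4 * b + 2, 4 * c + 3}"
  have by_residue: "v = (if v mod 4 = 0 then 0 else if v mod 4 = 1 then 4 * a + 1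
      else if v mod 4 = 2 then 4 * b + 2 else 4 * c + 3)" if v: "v \<in> ?A" for v
  proof -
    consider "v = 0" | "v = 4 * a + 1" | "v = 4 * b + 2" | "v = 4 * c + 3"
      using v by blast
    then show ?thesis
    proof cases
      case 1
      then show ?thesis by simp
    next
      case 2
      show ?thesis unfolding 2 residues_mod_4 by simp
    next
      case 3
      show ?thesis unfolding 3 residues_mod_4 by simp
    next
      case 4
      show ?thesis unfolding 4 residues_mod_4 by simp
    qed
  qed
  have w: "apery_element S 4 i = (if i = 0 then 0 else if i = 1 then 4 * a + 1
      else if i = 2 then 4 * b + 2 else 4 * c + 3)" if i: "i < 4" for i
  proof -
    have "apery_element S 4 i \<in> ?A"
      unfolding ap[symmetric] apery_set_def using i by simp
    moreover have "apery_element S 4 i mod 4 = i"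
      using apery_element_props(2)[OF S, of 4 i] i by simp
    ultimately show ?thesis
      using by_residue by metis
  qed
  have ap_mod: "apery_element S 4 n = apery_element S 4 (n mod 4)" for n
    unfolding apery_element_def by simp
  show eq: "S = kunz_semigroup a b c"
  proof (rule set_eqI)
    fix n :: nat
    have "n mod 4 \<in> {0, 1, 2, 3}" by auto
    then show "n \<in> S \<longleftrightarrow> n \<in> kunz_semigroup a b c"
      using w[of "n mod 4"] ap_mod[of n] mem_iff_apery_element_le[OF S _ four, of n]
      unfolding kunz_semigroup_def by auto
  qed
  have small: "n \<notin> S" if "0 < n" "n < 4" for n
    using multiplicity_props(3)[OF S, of n] mult that by auto
  have pos: "1 \<le> a" "1 \<le> b" "1 \<le> c"
    using small[of 1] small[of 2] small[of 3] unfolding eq kunz_semigroup_def by auto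
  have gen: "4 * a + 1 \<in> S" "4 * b + 2 \<in> S" "4 * c + 3 \<in> S"
    unfolding eq kunz_semigroup_generators by simp_all
  have add: "m + n \<in> S" if "m \<in> S" "n \<in> S" for m n
    using S that unfolding numerical_semigroup_def by blast
  have sums: "4 * (2 * a) + 2 = (4 * a + 1) + (4 * a + 1)"
      "4 * (a + b) + 3 = (4 * a + 1) + (4 * b + 2)"
      "4 * (b + c + 1) + 1 = (4 * b + 2) + (4 * c + 3)"
      "4 * (2 * c + 1) + 2 = (4 * c + 3) + (4 * c + 3)"
    by simp_all
  have "4 * (2 * a) + 2 \<in> S" "4 * (a + b) + 3 \<in> S" "4 * (b + c + 1) + 1 \<in> S"
      "4 * (2 * c + 1) + 2 \<in> S"
    unfolding sums by (intro add gen)+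
  then show "kunz_tuple a b c"
    unfolding eq kunz_semigroup_generators kunz_tuple_def using pos by simp
qed

lemma kunz_semigroup_exists:
  assumes S: "numerical_semigroup S" and mult: "multiplicity S = 4"
  obtains a b c where "S = kunz_semigroup a b c" "kunz_tuple a b c"
proof -
  have form: "\<exists>k. apery_element S 4 i = 4 * k + i" if "i < 4" for i
    using apery_element_props(2)[OF S, of 4 i] that
    by (metis mod_less mult_div_mod_eq zero_less_numeral)
  obtain a b c where abc: "apery_element S 4 1 = 4 * a + 1" "apery_element S 4 2 = 4 * b + 2"
      "apery_element S 4 3 = 4 * c + 3"
    using form[of 1] form[of 2] form[of 3] by auto
  have "0 \<in> S" using S unfolding numerical_semigroup_def by blast
  then have "apery_element S 4 0 = 0"
    unfolding apery_element_def by (intro Least_equality) auto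
  moreover have "{0..<4::nat} = {0, 1, 2, 3}" by auto
  ultimately have "apery_set S 4 = {0, 4 * a + 1, 4 * b + 2, 4 * c + 3}"
    unfolding apery_set_def using abc by simp
  from kunz_semigroup_of_apery_set[OF S mult this] that show thesis by blast
qed

section \<open>The lattice of Kunz tuples\<close>

lemma kunz_semigroup_subset_iff:
  "kunz_semigroup a b c \<subseteq> kunz_semigroup a' b' c' \<longleftrightarrow> a' \<le> a \<and> b' \<le> b \<and> c' \<le> c"
proof
  assume sub: "kunz_semigroup a b c \<subseteq> kunz_semigroup a' b' c'"
  have "4 * a + 1 \<in> kunz_semigroup a b c" "4 * b + 2 \<in> kunz_semigroup a b c"
      "4 * c + 3 \<in> kunz_semigroup a b c"
    unfolding kunz_semigroup_generators by (rule order_refl)+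
  from this[THEN subsetD[OF sub]] show "a' \<le> a \<and> b' \<le> b \<and> c' \<le> c"
    unfolding kunz_semigroup_generators by blast
next
  assume "a' \<le> a \<and> b' \<le> b \<and> c' \<le> c"
  then show "kunz_semigroup a b c \<subseteq> kunz_semigroup a' b' c'"
    unfolding kunz_semigroup_def by auto
qed

lemma kunz_semigroup_eq_iff:
  "kunz_semigroup a b c = kunz_semigroup a' b' c' \<longleftrightarrow> a = a' \<and> b = b' \<and> c = c'"
  by (auto simp: set_eq_subset kunz_semigroup_subset_iff)

lemma kunz_semigroup_Int:
  "kunz_semigroup a b c \<inter> kunz_semigroup a' b' c' =
     kunz_semigroup (max a a') (max b b') (max c c')"
  unfolding kunz_semigroup_def by (auto simp: max_def)

text \<open>The coordinate \<open>i\<close> to lower is the residue of the largest element of \<open>T - S\<close>,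
  where \<open>S\<close> and \<open>T\<close> have the tuples \<open>(x1, x2, x3)\<close> and \<open>(y1, y2, y3)\<close>. This element is the largest
  number \<open>4 * (xi - 1) + i\<close> among the coordinates with \<open>yi < xi\<close>. Doubling it, or
  adding to it a positive element of \<open>S\<close>, gives a larger element of \<open>T\<close>, which therefore lies
  in \<open>S\<close>.\<close>

lemma smaller_kunz_tuple_lowers_coordinate:
  assumes "kunz_tuple x1 x2 x3" "kunz_tuple y1 y2 y3"
    and "y1 \<le> x1" "y2 \<le> x2" "y3 \<le> x3" "(y1, y2, y3) \<noteq> (x1, x2, x3)"
  shows "(y1 < x1 \<and> kunz_tuple (x1 - 1) x2 x3) \<or> (y2 < x2 \<and> kunz_tuple x1 (x2 - 1) x3) \<or>
    (y3 < x3 \<and> kunz_tuple x1 x2 (x3 - 1))"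
proof -
  \<comment> \<open>In the consider below, \<open>i\<close> maximises \<open>4 * xi + i\<close> over the coordinates that differ.\<close>
  define dominates where
    "dominates = (\<lambda>i xi j yj xj. yj < xj \<longrightarrow> 4 * xj + j \<le> 4 * xi + (i::nat))"
  consider
      "y1 < x1" "dominates 1 x1 2 y2 x2" "dominates 1 x1 3 y3 x3"
    | "y2 < x2" "dominates 2 x2 1 y1 x1" "dominates 2 x2 3 y3 x3"
    | "y3 < x3" "dominates 3 x3 1 y1 x1" "dominates 3 x3 2 y2 x2"
    using assms(3-6) unfolding dominates_def by fastforce
  then show ?thesis
  proof cases
    case 1
    then have "kunz_tuple (x1 - 1) x2 x3"
      using assms unfolding kunz_tuple_def dominates_def by linarith
    with 1 show ?thesis by blast
  next
    case 2
    then have "kunz_tuple x1 (x2 - 1) x3"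
      using assms unfolding kunz_tuple_def dominates_def by linarith
    with 2 show ?thesis by blast
  next
    case 3
    then have "kunz_tuple x1 x2 (x3 - 1)"
      using assms unfolding kunz_tuple_def dominates_def by linarith
    with 3 show ?thesis by blast
  qed
qed

section \<open>The criterion for 4-irreducibility\<close>

lemma m_irreducible_kunz_semigroup_iff:
  assumes x: "kunz_tuple x1 x2 x3"
  defines "P1 \<equiv> kunz_tuple (x1 - 1) x2 x3"
    and "P2 \<equiv> kunz_tuple x1 (x2 - 1) x3"
    and "P3 \<equiv> kunz_tuple x1 x2 (x3 - 1)"
  shows "m_irreducible 4 (kunz_semigroup x1 x2 x3) \<longleftrightarrow>
    \<not> (P1 \<and> P2) \<and> \<not> (P1 \<and> P3) \<and> \<not> (P2 \<and> P3)"
proof -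
  let ?S = "kunz_semigroup x1 x2 x3"
  have pos: "0 < x1" "0 < x2" "0 < x3"
    using x unfolding kunz_tuple_def by auto
  have not_irreducible: "\<not> m_irreducible 4 ?S"
    if "kunz_tuple a b c" "kunz_tuple a' b' c'"
      "max a a' = x1" "max b b' = x2" "max c c' = x3"
      "(a, b, c) \<noteq> (x1, x2, x3)" "(a', b', c') \<noteq> (x1, x2, x3)" for a b c a' b' c'
  proof -
    let ?T = "kunz_semigroup a b c" and ?U = "kunz_semigroup a' b' c'"
    have "?S = ?T \<inter> ?U"
      using that by (simp add: kunz_semigroup_Int)
    moreover have "?S \<noteq> ?T" "?S \<noteq> ?U"
      using that(6,7) by (auto simp: kunz_semigroup_eq_iff)
    ultimately have "?S \<subset> ?T" "?S \<subset> ?U" "?S = ?T \<inter> ?U"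
      by blast+
    then show ?thesis
      unfolding m_irreducible_def
      using that(1,2) numerical_semigroup_kunz_semigroup multiplicity_kunz_semigroup by blast
  qed
  have "\<not> m_irreducible 4 ?S" if "P1 \<and> P2 \<or> P1 \<and> P3 \<or> P2 \<and> P3"
    using that
  proof (elim disjE)
    assume "P1 \<and> P2"
    then show ?thesis
      using not_irreducible[of "x1 - 1" x2 x3 x1 "x2 - 1" x3] pos
      unfolding P1_def P2_def by simp
  next
    assume "P1 \<and> P3"
    then show ?thesis
      using not_irreducible[of "x1 - 1" x2 x3 x1 x2 "x3 - 1"] pos
      unfolding P1_def P3_def by simp
  next
    assume "P2 \<and> P3"
    then show ?thesis
      using not_irreducible[of x1 "x2 - 1" x3 x1 x2 "x3 - 1"] pos
      unfolding P2_def P3_def by simp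
  qed
  moreover have "P1 \<and> P2 \<or> P1 \<and> P3 \<or> P2 \<and> P3" if red: "\<not> m_irreducible 4 ?S"
  proof -
    obtain T U where T: "numerical_semigroup T" "multiplicity T = 4" "?S \<subset> T"
      and U: "numerical_semigroup U" "multiplicity U = 4" "?S \<subset> U" and TU: "?S = T \<inter> U"
      using red numerical_semigroup_kunz_semigroup[OF x] multiplicity_kunz_semigroup[OF x]
      unfolding m_irreducible_def by blast
    obtain y1 y2 y3 where y: "T = kunz_semigroup y1 y2 y3" "kunz_tuple y1 y2 y3"
      using kunz_semigroup_exists[OF T(1,2)] .
    obtain z1 z2 z3 where z: "U = kunz_semigroup z1 z2 z3" "kunz_tuple z1 z2 z3"
      using kunz_semigroup_exists[OF U(1,2)] .
    have max: "x1 = max y1 z1" "x2 = max y2 z2" "x3 = max y3 z3"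
      using TU unfolding y z kunz_semigroup_Int kunz_semigroup_eq_iff by auto
    have ne: "(y1, y2, y3) \<noteq> (x1, x2, x3)" "(z1, z2, z3) \<noteq> (x1, x2, x3)"
      using T(3) U(3) y z by auto
    have "(y1 < x1 \<and> P1) \<or> (y2 < x2 \<and> P2) \<or> (y3 < x3 \<and> P3)"
      using smaller_kunz_tuple_lowers_coordinate[OF x y(2)] max ne(1)
      unfolding P1_def P2_def P3_def by simp
    moreover have "(z1 < x1 \<and> P1) \<or> (z2 < x2 \<and> P2) \<or> (z3 < x3 \<and> P3)"
      using smaller_kunz_tuple_lowers_coordinate[OF x z(2)] max ne(2)
      unfolding P1_def P2_def P3_def by simp
    moreover have "\<not> (y1 < x1 \<and> z1 < x1)" "\<not> (y2 < x2 \<and> z2 < x2)" "\<not> (y3 < x3 \<and> z3 < x3)"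
      using max by auto
    ultimately show ?thesis by blast
  qed
  ultimately show ?thesis by blast
qed

lemma kunz_tuple_lower_iff:
  assumes "kunz_tuple x1 x2 x3"
  shows "kunz_tuple (x1 - 1) x2 x3 \<longleftrightarrow> x2 + 2 \<le> 2 * x1 \<and> x3 + 1 \<le> x1 + x2"
    and "kunz_tuple x1 (x2 - 1) x3 \<longleftrightarrow> 2 \<le> x2 \<and> x3 + 1 \<le> x1 + x2 \<and> x1 \<le> x2 + x3"
    and "kunz_tuple x1 x2 (x3 - 1) \<longleftrightarrow> 2 \<le> x3 \<and> x1 \<le> x2 + x3 \<and> x2 + 1 \<le> 2 * x3"
  using assms unfolding kunz_tuple_def by auto

text \<open>
  The cases follow which inequality of \<open>kunz_tuple\<close> is tight. In case \<open>a\<close> it is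
  \<open>x3 = x1 + x2\<close>, which blocks the coordinates 1 and 2; in case \<open>b\<close> it is
  \<open>x1 = x2 + x3 + 1\<close>, which blocks 2 and 3. If neither is tight, then in cases \<open>c\<close> and \<open>d\<close> the
  first coordinate is blocked by \<open>x2 \<le> 2 * x1\<close>, and in case \<open>e\<close> it can be lowered, which pins
  down \<open>x2 = x3 = 1\<close>.
\<close>

lemma at_most_one_lowerable_iff:
  assumes x: "kunz_tuple x1 x2 x3"
  shows "\<not> (kunz_tuple (x1 - 1) x2 x3 \<and> kunz_tuple x1 (x2 - 1) x3) \<and>
      \<not> (kunz_tuple (x1 - 1) x2 x3 \<and> kunz_tuple x1 x2 (x3 - 1)) \<and>
      \<not> (kunz_tuple x1 (x2 - 1) x3 \<and> kunz_tuple x1 x2 (x3 - 1)) \<longleftrightarrow>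
    ((x1 = 1 \<and> x2 = 1 \<and> x3 = 1)
    \<or> (x1 + x2 \<ge> x3 + 1 \<and> 2 * x1 \<ge> x2 + 2 \<and> x2 + x3 + 1 \<le> x1)
    \<or> (x1 + x2 \<ge> x3 + 1 \<and> 2 * x1 \<ge> x2 + 2 \<and> x2 = 1 \<and> 2 * x3 \<le> x2)
    \<or> (x1 + x2 \<ge> x3 + 1 \<and> 2 * x1 \<ge> x2 + 2 \<and> x2 = 1 \<and> x2 + x3 + 1 \<le> x1)
    \<or> (x1 = 2 \<and> x2 = 1 \<and> x3 = 1)
    \<or> (x1 + x2 \<ge> x3 + 1 \<and> x2 + x3 \<ge> x1 \<and> 2 * x1 \<le> x2 + 1 \<and> 2 * x3 \<le> x2)
    \<or> (x2 + x3 \<ge> x1 \<and> 2 * x3 \<ge> x2 + 1 \<and> x1 + x2 \<le> x3))"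
    (is "?at_most_one \<longleftrightarrow> ?conds")
proof -
  note lower = kunz_tuple_lower_iff[OF x]
  have K: "1 \<le> x1" "1 \<le> x2" "1 \<le> x3" "x2 \<le> 2 * x1" "x3 \<le> x1 + x2" "x1 \<le> x2 + x3 + 1"
      "x2 \<le> 2 * x3 + 1"
    using x unfolding kunz_tuple_def by auto
  show ?thesis
  proof
    assume ?at_most_one
    note one = this[unfolded lower]
    consider (a) "x1 + x2 \<le> x3" | (b) "x2 + x3 + 1 \<le> x1"
      | (c) "x3 + 1 \<le> x1 + x2" "x1 \<le> x2 + x3" "2 * x1 \<le> x2 + 1" "x2 = 1"
      | (d) "x3 + 1 \<le> x1 + x2" "x1 \<le> x2 + x3" "2 * x1 \<le> x2 + 1" "2 \<le> x2"
      | (e) "x3 + 1 \<le> x1 + x2" "x1 \<le> x2 + x3" "x2 + 2 \<le> 2 * x1"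
      using K(2) by linarith
    then show ?conds
    proof cases
      case a
      with K have "x1 \<le> x2 + x3" "x2 + 1 \<le> 2 * x3" by linarith+
      with a show ?thesis by blast
    next
      case b
      with K have "x3 + 1 \<le> x1 + x2" "x2 + 2 \<le> 2 * x1" by linarith+
      with b show ?thesis by blast
    next
      case c
      with K have "x1 = 1" "x3 = 1" by linarith+
      with c(4) show ?thesis by blast
    next
      case d
      with one have "\<not> (2 \<le> x3 \<and> x2 + 1 \<le> 2 * x3)" by blast
      with d(4) have "2 * x3 \<le> x2" by linarith
      with d show ?thesis by blast
    next
      case e
      with one have "\<not> 2 \<le> x2" by blast
      with K(2) have "x2 = 1" by linarith
      from e one have "\<not> (2 \<le> x3 \<and> x2 + 1 \<le> 2 * x3)" by blast
      with K(3) \<open>x2 = 1\<close> have "x3 = 1" by linarith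
      with e \<open>x2 = 1\<close> have "x1 = 2" by linarith
      with \<open>x2 = 1\<close> \<open>x3 = 1\<close> show ?thesis by blast
    qed
  next
    assume ?conds
    then show ?at_most_one
      unfolding lower using K by (elim disjE conjE; intro conjI notI; elim conjE; linarith)
  qed
qed

theorem corollary22:
  fixes S :: "nat set" and x1 x2 x3 :: nat
  assumes "numerical_semigroup S"
    and "multiplicity S = 4"
    and "apery_set S 4 = {0, 4 * x1 + 1, 4 * x2 + 2, 4 * x3 + 3}"
  shows "m_irreducible 4 S \<longleftrightarrow>
      (x1 = 1 \<and> x2 = 1 \<and> x3 = 1)
    \<or> (x1 + x2 \<ge> x3 + 1 \<and> 2 * x1 \<ge> x2 + 2 \<and> int x2 + int x3 \<le> int x1 - 1)
    \<or> (x1 + x2 \<ge> x3 + 1 \<and> 2 * x1 \<ge> x2 + 2 \<and> x2 = 1 \<and> 2 * x3 \<le> x2)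
    \<or> (x1 + x2 \<ge> x3 + 1 \<and> 2 * x1 \<ge> x2 + 2 \<and> x2 = 1 \<and> int x2 + int x3 \<le> int x1 - 1)
    \<or> (x1 = 2 \<and> x2 = 1 \<and> x3 = 1)
    \<or> (x1 + x2 \<ge> x3 + 1 \<and> x2 + x3 \<ge> x1 \<and> 2 * x1 \<le> x2 + 1 \<and> 2 * x3 \<le> x2)
    \<or> (x2 + x3 \<ge> x1 \<and> 2 * x3 \<ge> x2 + 1 \<and> x1 + x2 \<le> x3)"
proof -
  note S = kunz_semigroup_of_apery_set[OF assms]
  have int_conv: "int x2 + int x3 \<le> int x1 - 1 \<longleftrightarrow> x2 + x3 + 1 \<le> x1"
    by linarith
  show ?thesis
    unfolding S(1) m_irreducible_kunz_semigroup_iff[OF S(2)] at_most_one_lowerable_iff[OF S(2)]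
      int_conv
    by (rule refl)
qed

end
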